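(* Let $p\in(0,1)$, $q=1-p$, $\rho=p/q$, and let $m$ be a fixed positive integer. Let $\mathfrak{it}_n$ be the total weight on $[n]$ of the virtual weighted species $\mathcal T$ of all tournaments with ties, and let $\mathfrak{it}^{(m)}_n$ be the total weight on $[n]$ of its subspecies of tournaments with ties consisting of exactly $m$ strongly connected components. Then, as $n\to\infty$, $$\frac{\mathfrak{it}^{(m)}_n}{\mathfrak{it}_n}\approx m\sum_{k\ge0}\Big(\mathfrak{it}^{(m-1)}_k-2\,\mathfrak{it}^{(m)}_k+\mathfrak{it}^{(m+1)}_k\Big)\cdot\binom nk\cdot\frac{q^{nk}}{q^{k(k+1)/2}},$$ where, by convention, $\mathfrak{it}^{(0)}_0=1$ and $\mathfrak{it}^{(0)}_k=0$ for $k>0$.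
   Context: A tournament with ties on $[n]=\{1,\dots,n\}$ is a directed graph with vertex set $[n]$ in which every pair of distinct vertices is joined either by exactly one directed edge (in one of the two directions) or by two oppositely directed edges. The weight of a tournament with ties $t$ is $w(t)=(\rho-1)^{\ell}$, where $\ell$ is the number of pairs of vertices joined by two edges (with $0^0=1$); weights may be negative if $\rho<1$. Total weight on $[n]$ means the sum of the weights of all the relevant tournaments with ties on $[n]$. For $j\ge1$ one has $\mathfrak{it}^{(j)}_0=0$ (the empty tournament has $0$ strongly connected components). Notation $\approx$: $p_n\approx\sum_{k\ge0}c_kg_k(n)$ (here $g_k(n)=\binom nk q^{nk-k(k+1)/2}$) means that $g_{k+1}(n)=o(g_k(n))$ for every $k$ and, for every integer $r\ge0$, $p_n=\sum_{k=0}^rc_kg_k(n)+O(g_{r+1}(n))$ as $n\to\infty$. *)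

theory Defs
  imports
    "Graph_Theory.Graph_Theory"
    "HOL-Library.Landau_Symbols"
    Complex_Main
begin

text \<open>\<^locale>\<open>pair_digraph\<close>: finite digraphs without loops and without parallel arcs.
  Oppositely directed arcs are allowed; they are the ties.\<close>

definition tournament_with_ties :: "nat \<Rightarrow> nat pair_pre_digraph \<Rightarrow> bool" where
  "tournament_with_ties n T \<longleftrightarrow>
     pair_digraph T \<and> pverts T = {1..n} \<and>
     (\<forall>i\<in>{1..n}. \<forall>j\<in>{1..n}. i \<noteq> j \<longrightarrow> (i, j) \<in> parcs T \<or> (j, i) \<in> parcs T)"

definition tied_pairs :: "nat pair_pre_digraph \<Rightarrow> nat set set" where
  "tied_pairs T = {{i, j} | i j. i \<noteq> j \<and> (i, j) \<in> parcs T \<and> (j, i) \<in> parcs T}"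

definition tie_weight :: "real \<Rightarrow> nat pair_pre_digraph \<Rightarrow> real" where
  "tie_weight \<rho> T = (\<rho> - 1) ^ card (tied_pairs T)"

definition num_sccs :: "nat pair_pre_digraph \<Rightarrow> nat" where
  "num_sccs T = card (pre_digraph.sccs (with_proj T))"

definition it :: "real \<Rightarrow> nat \<Rightarrow> real" where
  "it \<rho> n = (\<Sum>T | tournament_with_ties n T. tie_weight \<rho> T)"

text \<open>For \<open>m = 0\<close> only the empty tournament contributes, so the convention for zero
  components needs no separate clause; see \<open>it_sccs_zero\<close> below.\<close>

definition it_sccs :: "real \<Rightarrow> nat \<Rightarrow> nat \<Rightarrow> real" where
  "it_sccs \<rho> m n = (\<Sum>T | tournament_with_ties n T \<and> num_sccs T = m. tie_weight \<rho> T)"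

text \<open>\<open>p n \<approx> (\<Sum>k. c k * g k n)\<close> as \<open>n\<close> tends to infinity; the series need not converge.\<close>

definition asymp_series :: "(nat \<Rightarrow> real) \<Rightarrow> (nat \<Rightarrow> real) \<Rightarrow> (nat \<Rightarrow> nat \<Rightarrow> real) \<Rightarrow> bool" where
  "asymp_series p c g \<longleftrightarrow>
     (\<forall>k. g (Suc k) \<in> o(g k)) \<and>
     (\<forall>r. (\<lambda>n. p n - (\<Sum>k\<le>r. c k * g k n)) \<in> O(g (Suc r)))"

lemma finite_tournaments_with_ties: "finite {T. tournament_with_ties n T}"
proof (rule finite_subset)
  show "{T. tournament_with_ties n T} \<subseteq>
      (\<lambda>A. \<lparr>pverts = {1..n}, parcs = A\<rparr>) ` Pow ({1..n} \<times> {1..n})"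
  proof
    fix T assume "T \<in> {T. tournament_with_ties n T}"
    then have T: "pair_digraph T" "pverts T = {1..n}"
      by (auto simp: tournament_with_ties_def)
    then interpret pair_digraph T by simp
    have "parcs T \<subseteq> {1..n} \<times> {1..n}"
      using in_arcsD1 in_arcsD2 T(2) by auto
    with T(2) show "T \<in> (\<lambda>A. \<lparr>pverts = {1..n}, parcs = A\<rparr>) ` Pow ({1..n} \<times> {1..n})"
      by (intro image_eqI[of _ _ "parcs T"]) auto
  qed
qed simp

lemma num_sccs_eq_0_iff:
  assumes "tournament_with_ties n T"
  shows "num_sccs T = 0 \<longleftrightarrow> n = 0"
proof -
  from assms interpret pair_digraph T by (simp add: tournament_with_ties_def)
  have V: "pverts T = {1..n}" using assms by (simp add: tournament_with_ties_def)
  have "num_sccs T = card sccs_verts"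
    by (simp add: num_sccs_def card_sccs_verts)
  moreover have "sccs_verts = scc_of ` {1..n}"
    using sccs_verts_conv_scc_of V by simp
  ultimately show ?thesis by auto
qed

lemma it_sccs_zero: "it_sccs \<rho> 0 k = (if k = 0 then 1 else 0)"
proof (cases "k = 0")
  case True
  have "tournament_with_ties 0 T \<longleftrightarrow> T = \<lparr>pverts = {}, parcs = {}\<rparr>" for T
  proof
    assume T: "tournament_with_ties 0 T"
    then interpret pair_digraph T by (simp add: tournament_with_ties_def)
    have "pverts T = {}" using T by (simp add: tournament_with_ties_def)
    then show "T = \<lparr>pverts = {}, parcs = {}\<rparr>"
      using in_arcsD1 by (cases T) auto
  qed (auto simp: tournament_with_ties_def intro!: pair_digraph.intro pair_fin_digraph.intro
      pair_loopfree_digraph.intro pair_wf_digraph.intro pair_fin_digraph_axioms.intro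
      pair_loopfree_digraph_axioms.intro)
  moreover have "{T. tournament_with_ties 0 T \<and> num_sccs T = 0} = {T. tournament_with_ties 0 T}"
    using num_sccs_eq_0_iff by auto
  ultimately show ?thesis
    using True by (simp add: it_sccs_def tie_weight_def tied_pairs_def)
next
  case False
  then have "{T. tournament_with_ties k T \<and> num_sccs T = 0} = {}"
    using num_sccs_eq_0_iff by auto
  with False show ?thesis by (simp only: it_sccs_def sum.empty if_False)
qed

end

theory Submission
  imports Defs "HOL-Computational_Algebra.Formal_Power_Series" "HOL-Real_Asymp.Real_Asymp"
begin

text \<open>
  Every nonempty tournament with ties splits uniquely into its initial strong component and the
  tournament on the remaining vertices, all arcs in between pointing out of the component. Hence, if \<open>T\<close> and \<open>S\<close> are the
  exponential generating functions of all and of the strongly connected tournaments with ties,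
  \<open>T - 1 = S * T\<close>, and \<open>S ^ m\<close> is the generating function of those with \<open>m\<close> components. Choosing the
  arcs pair by pair gives \<open>T = (\<Sum>n. a n * z ^ n)\<close> with \<open>a n = q powr (- (n choose 2)) / n!\<close>.

  These coefficients grow so fast that a product of two series with coefficients \<open>O(a n)\<close> is governed by
  its extreme terms. Consequently the map sending \<open>F\<close> to the series \<open>D\<close> with
  \<open>F $ n \<approx> (\<Sum>k. D $ k * a (n - k))\<close> is a derivation with \<open>T \<mapsto> 1\<close>, as in Bender's theorem. It sends
  \<open>S = 1 - 1 / T\<close> to \<open>1 / T\<^sup>2 = (1 - S)\<^sup>2\<close> and \<open>S ^ m\<close> to \<open>m * S ^ (m - 1) * (1 - S)\<^sup>2\<close>.
\<close>

unbundle fps_syntax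

section \<open>Semicomplete relations and their initial component\<close>

text \<open>Tournaments with ties become bare arc relations on an arbitrary vertex set, because the
  decomposition into components passes to subsets of \<open>{1..n}\<close>.\<close>

definition semicomplete :: "'a set \<Rightarrow> 'a rel set" where
  "semicomplete V = {E. E \<subseteq> V \<times> V \<and> irrefl E \<and> total_on V E}"

definition ties :: "'a rel \<Rightarrow> 'a set set" where
  "ties E = {{i, j} | i j. i \<noteq> j \<and> (i, j) \<in> E \<and> (j, i) \<in> E}"

definition strong_class :: "'a rel \<Rightarrow> 'a \<Rightarrow> 'a set" where
  "strong_class E u = {v. (u, v) \<in> E\<^sup>* \<and> (v, u) \<in> E\<^sup>*}"

definition num_classes :: "'a set \<Rightarrow> 'a rel \<Rightarrow> nat" where
  "num_classes V E = card (strong_class E ` V)"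

lemma semicomplete_restrict:
  assumes "E \<in> semicomplete V" "A \<subseteq> V"
  shows "E \<inter> A \<times> A \<in> semicomplete A"
proof -
  have "total_on A (E \<inter> A \<times> A)"
    unfolding total_on_def
  proof (intro ballI impI)
    fix x y assume xy: "x \<in> A" "y \<in> A" "x \<noteq> y"
    with assms have "(x, y) \<in> E \<or> (y, x) \<in> E"
      by (auto simp: semicomplete_def total_on_def)
    with xy show "(x, y) \<in> E \<inter> A \<times> A \<or> (y, x) \<in> E \<inter> A \<times> A" by simp
  qed
  with assms show ?thesis by (auto simp: semicomplete_def irrefl_def)
qed

lemma finite_semicomplete: "finite V \<Longrightarrow> finite (semicomplete V)"
  by (rule finite_subset[of _ "Pow (V \<times> V)"]) (auto simp: semicomplete_def)

text \<open>The empty set is removed so that tie families living on disjoint vertex sets are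
  themselves disjoint.\<close>

lemma ties_subset: "E \<subseteq> V \<times> V \<Longrightarrow> ties E \<subseteq> Pow V - {{}}"
  by (auto simp: ties_def)

lemma finite_ties:
  assumes "finite V" "E \<subseteq> V \<times> V"
  shows "finite (ties E)"
  using ties_subset[OF assms(2)] assms(1) by (meson finite_Diff finite_Pow_iff finite_subset)

lemma rtrancl_within:
  assumes "E \<subseteq> V \<times> V" "(u, v) \<in> E\<^sup>*" "u \<in> V"
  shows "v \<in> V"
  using assms(2,3) by induction (use assms(1) in auto)

lemma strong_class_subset:
  assumes "E \<subseteq> V \<times> V" "u \<in> V"
  shows "strong_class E u \<subseteq> V"
  using rtrancl_within[OF assms(1) _ assms(2)] by (auto simp: strong_class_def)

lemma strong_class_self: "u \<in> strong_class E u"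
  by (simp add: strong_class_def)

lemma strong_class_eq_iff: "strong_class E u = strong_class E v \<longleftrightarrow> (u, v) \<in> E\<^sup>* \<and> (v, u) \<in> E\<^sup>*"
  unfolding strong_class_def by (auto intro: rtrancl_trans)

lemma num_classes_eq_1_iff:
  "num_classes V E = 1 \<longleftrightarrow> V \<noteq> {} \<and> (\<forall>u\<in>V. \<forall>v\<in>V. (u, v) \<in> E\<^sup>*)"
proof
  assume "num_classes V E = 1"
  then obtain C where "strong_class E ` V = {C}"
    by (auto simp: num_classes_def card_1_singleton_iff)
  then have "V \<noteq> {}" and "\<forall>u\<in>V. \<forall>v\<in>V. strong_class E u = strong_class E v"
    by (auto, metis image_eqI singletonD)+
  then show "V \<noteq> {} \<and> (\<forall>u\<in>V. \<forall>v\<in>V. (u, v) \<in> E\<^sup>*)"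
    by (simp add: strong_class_eq_iff)
next
  assume *: "V \<noteq> {} \<and> (\<forall>u\<in>V. \<forall>v\<in>V. (u, v) \<in> E\<^sup>*)"
  then obtain u where "u \<in> V" by auto
  with * have "strong_class E ` V = {strong_class E u}"
    by (auto simp: strong_class_eq_iff image_iff) (metis strong_class_eq_iff)+
  then show "num_classes V E = 1"
    by (simp add: num_classes_def)
qed

section \<open>The initial strong component\<close>

definition kings :: "'a set \<Rightarrow> 'a rel \<Rightarrow> 'a set" where
  "kings V E = {a \<in> V. \<forall>v\<in>V. (a, v) \<in> E\<^sup>*}"

text \<open>Closure under predecessors is what makes the kings, whenever there are any, the initial
  strong component: they reach one another, and no arc enters from outside.\<close>

lemma no_arc_into_kings:
  assumes "E \<subseteq> V \<times> V" "(x, a) \<in> E" "a \<in> kings V E"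
  shows "x \<in> kings V E"
  using assms by (auto simp: kings_def intro: converse_rtrancl_into_rtrancl)

text \<open>A vertex whose set of reachable vertices is as large as possible reaches everything.\<close>

lemma kings_nonempty:
  assumes E: "E \<in> semicomplete V" and "finite V" "V \<noteq> {}"
  shows "kings V E \<noteq> {}"
proof -
  have EV: "E \<subseteq> V \<times> V" and tot: "total_on V E"
    using E by (auto simp: semicomplete_def)
  obtain v where v: "v \<in> V" "\<And>u. u \<in> V \<Longrightarrow> card (E\<^sup>* `` {u}) \<le> card (E\<^sup>* `` {v})"
  proof -
    let ?M = "Max ((\<lambda>u. card (E\<^sup>* `` {u})) ` V)"
    have "?M \<in> (\<lambda>u. card (E\<^sup>* `` {u})) ` V"
      using assms(2,3) by (intro Max_in) auto
    then obtain v where "v \<in> V" "?M = card (E\<^sup>* `` {v})" by auto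
    then show thesis
      using assms(2) by (intro that[of v]) (metis Max_ge finite_imageI image_eqI)+
  qed
  have "(v, x) \<in> E\<^sup>*" if x: "x \<in> V" for x
  proof (rule ccontr)
    assume nx: "(v, x) \<notin> E\<^sup>*"
    then have "x \<noteq> v" "(v, x) \<notin> E" by auto
    then have "(x, v) \<in> E"
      using tot x v(1) by (auto simp: total_on_def)
    then have "E\<^sup>* `` {v} \<subset> E\<^sup>* `` {x}"
      using nx by (auto intro: converse_rtrancl_into_rtrancl)
    moreover have "finite (E\<^sup>* `` {x})"
      using rtrancl_within[OF EV _ x] by (intro finite_subset[OF _ assms(2)]) auto
    ultimately show False
      using v(2)[OF x] psubset_card_mono by (meson leD)
  qed
  with v(1) show ?thesis by (auto simp: kings_def)
qed

section \<open>Gluing a first component to the remaining vertices\<close>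

definition glue :: "'a set \<Rightarrow> 'a set \<Rightarrow> 'a rel \<Rightarrow> 'a rel \<Rightarrow> 'a rel" where
  "glue V A E1 E2 = E1 \<union> E2 \<union> A \<times> (V - A)"

context
  fixes V A :: "'a set" and E1 E2 :: "'a rel"
  assumes A: "A \<subseteq> V" and E1: "E1 \<in> semicomplete A" and E2: "E2 \<in> semicomplete (V - A)"
begin

lemma glue_semicomplete: "glue V A E1 E2 \<in> semicomplete V"
proof -
  have "total_on V (glue V A E1 E2)"
    unfolding total_on_def
  proof (intro ballI impI)
    fix x y assume "x \<in> V" "y \<in> V" "x \<noteq> y"
    with E1 E2 show "(x, y) \<in> glue V A E1 E2 \<or> (y, x) \<in> glue V A E1 E2"
      by (cases "x \<in> A"; cases "y \<in> A") (auto simp: glue_def semicomplete_def total_on_def)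
  qed
  moreover have "irrefl (glue V A E1 E2)" "glue V A E1 E2 \<subseteq> V \<times> V"
    using A E1 E2 by (auto simp: glue_def semicomplete_def irrefl_def)
  ultimately show ?thesis by (simp add: semicomplete_def)
qed

text \<open>No arc leads from \<open>V - A\<close> back to \<open>A\<close>, so a tie lies inside
  one of the two blocks.\<close>

lemma ties_glue: "ties (glue V A E1 E2) = ties E1 \<union> ties E2"
proof -
  have "(i, j) \<in> glue V A E1 E2 \<and> (j, i) \<in> glue V A E1 E2 \<longleftrightarrow>
     (i, j) \<in> E1 \<and> (j, i) \<in> E1 \<or> (i, j) \<in> E2 \<and> (j, i) \<in> E2" for i j
    using A E1 E2 by (auto simp: glue_def semicomplete_def)
  then show ?thesis unfolding ties_def by auto
qed

lemma card_ties_glue: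
  assumes "finite V"
  shows "card (ties (glue V A E1 E2)) = card (ties E1) + card (ties E2)"
proof -
  have sub: "E1 \<subseteq> A \<times> A" "E2 \<subseteq> (V - A) \<times> (V - A)"
    using E1 E2 by (auto simp: semicomplete_def)
  have "ties E1 \<inter> ties E2 = {}"
    using ties_subset[OF sub(1)] ties_subset[OF sub(2)] by blast
  moreover have "finite (ties E1)" "finite (ties E2)"
    using finite_ties[OF _ sub(1)] finite_ties[OF _ sub(2)] A assms finite_subset by auto
  ultimately show ?thesis
    by (simp add: ties_glue card_Un_disjoint)
qed

lemma glue_restrict: "glue V A E1 E2 \<inter> A \<times> A = E1"
  "glue V A E1 E2 \<inter> (V - A) \<times> (V - A) = E2"
  using E1 E2 by (auto simp: glue_def semicomplete_def)

text \<open>A walk that starts outside \<open>A\<close> can never enter \<open>A\<close>, so it uses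
  arcs of \<open>E2\<close> only.\<close>

lemma glue_rtrancl_rest:
  assumes "(u, v) \<in> (glue V A E1 E2)\<^sup>*" "u \<in> V - A"
  shows "v \<in> V - A \<and> (u, v) \<in> E2\<^sup>*"
  using assms
proof induction
  case (step y z)
  then have y: "y \<in> V - A" "(u, y) \<in> E2\<^sup>*" by auto
  moreover from step.hyps(2) y E1 E2 have "(y, z) \<in> E2" "z \<in> V - A"
    by (auto simp: glue_def semicomplete_def)
  ultimately show ?case by auto
qed auto

lemma strong_class_glue_rest:
  assumes "u \<in> V - A"
  shows "strong_class (glue V A E1 E2) u = strong_class E2 u"
proof -
  have "E2\<^sup>* \<subseteq> (glue V A E1 E2)\<^sup>*"
    by (rule rtrancl_mono) (auto simp: glue_def)
  then show ?thesis
    using glue_rtrancl_rest assms unfolding strong_class_def by blast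
qed

context
  assumes strong: "num_classes A E1 = 1"
begin

lemma glue_rtrancl_first:
  assumes "a \<in> A" "v \<in> V"
  shows "(a, v) \<in> (glue V A E1 E2)\<^sup>*"
proof (cases "v \<in> A")
  case True
  have "E1\<^sup>* \<subseteq> (glue V A E1 E2)\<^sup>*"
    by (rule rtrancl_mono) (auto simp: glue_def)
  with True strong assms show ?thesis
    unfolding num_classes_eq_1_iff by auto
qed (use assms in \<open>auto simp: glue_def\<close>)

text \<open>Uniqueness of the splitting: the first block can be read off from the glued relation.
  Vertices of \<open>A\<close> reach everything, and the others miss the nonempty set
  \<open>A\<close>.\<close>

lemma kings_glue: "kings V (glue V A E1 E2) = A"
proof -
  obtain a where "a \<in> A" using strong unfolding num_classes_eq_1_iff by auto
  then have "u \<notin> kings V (glue V A E1 E2)" if "u \<in> V - A" for u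
    using glue_rtrancl_rest[OF _ that, of a] A by (auto simp: kings_def)
  moreover have "A \<subseteq> kings V (glue V A E1 E2)"
    using glue_rtrancl_first A by (auto simp: kings_def)
  ultimately show ?thesis by (auto simp: kings_def)
qed

text \<open>The block \<open>A\<close> is one class, and the remaining classes are those of
  \<open>E2\<close>.\<close>

lemma num_classes_glue:
  assumes "finite V"
  shows "num_classes V (glue V A E1 E2) = Suc (num_classes (V - A) E2)"
proof -
  let ?E = "glue V A E1 E2"
  have "A \<noteq> {}" using strong unfolding num_classes_eq_1_iff by auto
  have cA: "strong_class ?E a = A" if a: "a \<in> A" for a
  proof
    show "A \<subseteq> strong_class ?E a"
      using a A glue_rtrancl_first unfolding strong_class_def by auto
    have "v \<notin> strong_class ?E a" if "v \<notin> A" for v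
    proof
      assume v: "v \<in> strong_class ?E a"
      have "?E \<subseteq> V \<times> V" using glue_semicomplete by (auto simp: semicomplete_def)
      with v a A have "v \<in> V" using strong_class_subset[of ?E V a] by auto
      with v that glue_rtrancl_rest[of v a] a show False
        by (auto simp: strong_class_def)
    qed
    then show "strong_class ?E a \<subseteq> A" by auto
  qed
  have "strong_class ?E ` V = strong_class ?E ` A \<union> strong_class ?E ` (V - A)"
    using A by auto
  also have "\<dots> = insert A (strong_class E2 ` (V - A))"
    using cA \<open>A \<noteq> {}\<close> strong_class_glue_rest by auto
  finally have "strong_class ?E ` V = insert A (strong_class E2 ` (V - A))" .
  \<comment> \<open>A class contains the vertex it belongs to, and that vertex lies outside
    \<open>A\<close>; so \<open>insert\<close> adds a new element.\<close>
  moreover have "A \<notin> strong_class E2 ` (V - A)"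
    using strong_class_self by fastforce
  ultimately show ?thesis
    using assms by (simp add: num_classes_def)
qed

end

end

text \<open>Existence of the splitting. Since no arc enters the kings from outside, totality forces
  an arc from every king to every other vertex, so the two restrictions determine
  \<open>E\<close>.\<close>

lemma kings_decomposition:
  assumes E: "E \<in> semicomplete V" and "finite V" "V \<noteq> {}"
  defines "A \<equiv> kings V E"
  shows "A \<subseteq> V" "E \<inter> A \<times> A \<in> semicomplete A" "E \<inter> (V - A) \<times> (V - A) \<in> semicomplete (V - A)"
    "glue V A (E \<inter> A \<times> A) (E \<inter> (V - A) \<times> (V - A)) = E"
    "num_classes A (E \<inter> A \<times> A) = 1"
proof -
  have EV: "E \<subseteq> V \<times> V" and tot: "total_on V E"
    using E by (auto simp: semicomplete_def)
  have enter: "x \<in> A" if "(x, a) \<in> E" "a \<in> A" for x a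
    using no_arc_into_kings[OF EV] that unfolding A_def by blast
  show AV: "A \<subseteq> V" by (auto simp: A_def kings_def)
  then show "E \<inter> A \<times> A \<in> semicomplete A" "E \<inter> (V - A) \<times> (V - A) \<in> semicomplete (V - A)"
    by (auto intro!: semicomplete_restrict[OF E])
  show "glue V A (E \<inter> A \<times> A) (E \<inter> (V - A) \<times> (V - A)) = E"
  proof (rule set_eqI, clarify)
    fix x y
    have "(x, y) \<in> E" if "x \<in> A" "y \<in> V - A"
    proof -
      have "(y, x) \<notin> E" using enter[of y x] that by auto
      moreover have "x \<in> V" "x \<noteq> y" using that AV by auto
      ultimately show ?thesis using tot that by (auto simp: total_on_def)
    qed
    moreover have "x \<in> V" "y \<in> V" if "(x, y) \<in> E"
      using that EV by auto
    moreover have "x \<in> A" if "(x, y) \<in> E" "y \<in> A"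
      using enter that by blast
    moreover have "(x, y) \<in> glue V A (E \<inter> A \<times> A) (E \<inter> (V - A) \<times> (V - A)) \<longleftrightarrow>
        (x, y) \<in> E \<and> x \<in> A \<and> y \<in> A \<or> (x, y) \<in> E \<and> x \<in> V - A \<and> y \<in> V - A \<or> x \<in> A \<and> y \<in> V - A"
      by (auto simp: glue_def)
    ultimately show "(x, y) \<in> glue V A (E \<inter> A \<times> A) (E \<inter> (V - A) \<times> (V - A)) \<longleftrightarrow> (x, y) \<in> E"
      by blast
  qed
  \<comment> \<open>Followed backwards from its end in \<open>A\<close>, a walk never leaves
    \<open>A\<close>. Hence the kings reach one another within \<open>A\<close>.\<close>
  have "(u, v) \<in> (E \<inter> A \<times> A)\<^sup>*" if "(u, v) \<in> E\<^sup>*" "v \<in> A" for u v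
  proof -
    from that have "(u, v) \<in> (E \<inter> A \<times> A)\<^sup>* \<and> u \<in> A"
    proof (induction rule: converse_rtrancl_induct)
      case (step y z)
      then show ?case using enter by (meson IntI SigmaI converse_rtrancl_into_rtrancl)
    qed auto
    then show ?thesis by simp
  qed
  moreover have "A \<noteq> {}" using kings_nonempty[OF assms(1-3)] by (simp add: A_def)
  ultimately show "num_classes A (E \<inter> A \<times> A) = 1"
    unfolding num_classes_eq_1_iff using AV by (auto simp: A_def kings_def)
qed

section \<open>Weighted recurrences from splitting off the first component\<close>

definition class_weight :: "real \<Rightarrow> nat \<Rightarrow> 'a set \<Rightarrow> real" where
  "class_weight c m V = (\<Sum>E | E \<in> semicomplete V \<and> num_classes V E = m. c ^ card (ties E))"

definition total_weight :: "real \<Rightarrow> 'a set \<Rightarrow> real" where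
  "total_weight c V = (\<Sum>E\<in>semicomplete V. c ^ card (ties E))"

text \<open>The property \<open>P\<close> is a parameter so that one bijection yields both
  recurrences below, with and without a prescribed number of components. It may be any property
  that, after gluing, depends on the rest alone.\<close>

lemma sum_first_component:
  fixes V :: "'a set"
  assumes V: "finite V" "V \<noteq> {}"
    and P: "\<And>A E1 E2. A \<subseteq> V \<Longrightarrow> E1 \<in> semicomplete A \<Longrightarrow> E2 \<in> semicomplete (V - A) \<Longrightarrow>
       num_classes A E1 = 1 \<Longrightarrow> P (glue V A E1 E2) \<longleftrightarrow> Q (V - A) E2"
  shows "(\<Sum>E | E \<in> semicomplete V \<and> P E. c ^ card (ties E)) =
    (\<Sum>A\<in>Pow V. class_weight c 1 A * (\<Sum>E | E \<in> semicomplete (V - A) \<and> Q (V - A) E. c ^ card (ties E)))"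
    (is "?lhs = (\<Sum>A\<in>_. _ * ?R A)")
proof -
  define X where "X A = {E. E \<in> semicomplete A \<and> num_classes A E = 1}" for A :: "'a set"
  define Y where "Y A = {E. E \<in> semicomplete (V - A) \<and> Q (V - A) E}" for A
  have fin: "finite (X A)" "finite (Y A)" if "A \<subseteq> V" for A
    using finite_semicomplete[of A] finite_semicomplete[of "V - A"] V that
    by (auto simp: X_def Y_def intro: finite_subset)
  have "(\<Sum>A\<in>Pow V. class_weight c 1 A * ?R A) =
      (\<Sum>A\<in>Pow V. \<Sum>(E1, E2)\<in>X A \<times> Y A. c ^ (card (ties E1) + card (ties E2)))"
    by (simp add: class_weight_def X_def Y_def sum_product sum.cartesian_product power_add)
  also have "\<dots> = (\<Sum>(A, E1, E2)\<in>(SIGMA A:Pow V. X A \<times> Y A). c ^ (card (ties E1) + card (ties E2)))"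
    using V fin by (subst sum.Sigma) (auto simp: split_def)
  \<comment> \<open>Splitting at the kings and gluing are mutually inverse, and the numbers of ties
    add up.\<close>
  also have "\<dots> = ?lhs"
  proof (rule sum.reindex_bij_witness[of _
        "\<lambda>E. let A = kings V E in (A, E \<inter> A \<times> A, E \<inter> (V - A) \<times> (V - A))"
        "\<lambda>(A, E1, E2). glue V A E1 E2"], goal_cases)
    case (1 t)
    then show ?case
      by (cases t) (auto simp: X_def Y_def Let_def kings_glue glue_restrict)
  next
    case (2 t)
    then show ?case
      using P by (cases t) (auto simp: X_def Y_def glue_semicomplete)
  next
    case (3 E)
    then show ?case using kings_decomposition(4)[OF _ V] by (simp add: Let_def)
  next
    case (4 E)
    then have E: "E \<in> semicomplete V" "P E" by auto
    note d = kings_decomposition[OF E(1) V]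
    from P[OF d(1-3,5)] d(4) E(2) show ?case
      using d by (simp add: Let_def X_def Y_def)
  next
    case (5 t)
    then show ?case
      using V by (cases t) (auto simp: X_def Y_def card_ties_glue)
  qed
  finally show ?thesis ..
qed

lemma class_weight_Suc:
  assumes "finite V" "V \<noteq> {}"
  shows "class_weight c (Suc m) V = (\<Sum>A\<in>Pow V. class_weight c 1 A * class_weight c m (V - A))"
  unfolding class_weight_def[of c "Suc m"] class_weight_def[of c m]
  by (rule sum_first_component) (use assms in \<open>auto simp: num_classes_glue\<close>)

lemma total_weight_first_component:
  assumes "finite V" "V \<noteq> {}"
  shows "total_weight c V = (\<Sum>A\<in>Pow V. class_weight c 1 A * total_weight c (V - A))"
  using sum_first_component[OF assms, of "\<lambda>_. True" "\<lambda>_ _. True" c]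
  by (simp add: total_weight_def)

section \<open>Generating functions\<close>

lemma sum_Pow_power_card:
  fixes x :: "'b::comm_semiring_1"
  assumes "finite A"
  shows "(\<Sum>B\<in>Pow A. x ^ card B) = (x + 1) ^ card A"
  using prod_add[OF assms, of "\<lambda>_. x" "\<lambda>_. 1"] by simp

lemma semicomplete_empty [simp]: "semicomplete {} = {{}}"
  by (auto simp: semicomplete_def irrefl_def total_on_def)

lemma ties_empty [simp]: "ties {} = {}"
  by (simp add: ties_def)

lemma total_weight_empty [simp]: "total_weight c {} = 1"
  by (simp add: total_weight_def)

text \<open>Each old vertex is joined to \<open>v\<close> in one of three ways: by one arc in either
  direction, of weight 1 each, or by a tie, of weight \<open>c\<close>. This gives a factor
  \<open>c + 2\<close> per old vertex.\<close>

lemma total_weight_insert: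
  assumes V: "finite V" and v: "v \<notin> V"
  shows "total_weight c (insert v V) = total_weight c V * (c + 2) ^ card V"
proof -
  \<comment> \<open>\<open>X\<close> holds the out-neighbours of \<open>v\<close>, and
    \<open>Z\<close> those of them that are tied to \<open>v\<close>. Arcs into \<open>v\<close>
    come from the vertices outside \<open>X\<close> and from \<open>Z\<close>.\<close>
  define join where "join = (\<lambda>(E, X, Z). E \<union> {v} \<times> X \<union> ((V - X) \<union> Z) \<times> {v})"
  define I where "I = semicomplete V \<times> (SIGMA X:Pow V. Pow X)"
  \<comment> \<open>Binomial theorem twice: the sum over \<open>Z\<close> gives
    \<open>(c + 1) ^ card X\<close>, and the sum over \<open>X\<close> then gives
    \<open>(c + 1 + 1) ^ card V\<close>.\<close>
  have "total_weight c V * (c + 2) ^ card V =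
      total_weight c V * (\<Sum>X\<in>Pow V. \<Sum>Z\<in>Pow X. c ^ card Z)"
  proof -
    have "(\<Sum>X\<in>Pow V. \<Sum>Z\<in>Pow X. c ^ card Z) = (\<Sum>X\<in>Pow V. (c + 1) ^ card X)"
      using V by (intro sum.cong refl sum_Pow_power_card) (auto intro: finite_subset)
    then show ?thesis using sum_Pow_power_card[OF V, of "c + 1"] by (simp add: add.assoc)
  qed
  also have "(\<Sum>X\<in>Pow V. \<Sum>Z\<in>Pow X. c ^ card Z) = (\<Sum>(X, Z)\<in>(SIGMA X:Pow V. Pow X). c ^ card Z)"
    using V by (subst sum.Sigma) (auto intro: finite_subset)
  also have "total_weight c V * \<dots> = (\<Sum>(E, X, Z)\<in>I. c ^ (card (ties E) + card Z))"
    by (simp add: I_def total_weight_def sum_product sum.cartesian_product power_add split_def)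
  also have "\<dots> = (\<Sum>E\<in>semicomplete (insert v V). c ^ card (ties E))"
  proof (rule sum.reindex_bij_witness[of _
        "\<lambda>E. (E \<inter> V \<times> V, {u\<in>V. (v, u) \<in> E}, {u\<in>V. (v, u) \<in> E \<and> (u, v) \<in> E})" join], goal_cases)
    case (1 t)
    then show ?case using v
      by (cases t) (auto simp: I_def join_def semicomplete_def)
  next
    case (2 t)
    obtain E X Z where t: "t = (E, X, Z)" by (cases t)
    with 2 have *: "E \<subseteq> V \<times> V" "irrefl E" "total_on V E" "X \<subseteq> V" "Z \<subseteq> X"
      by (auto simp: I_def semicomplete_def)
    then have "total_on (insert v V) (join t)"
      by (auto simp: t join_def total_on_def)
    with * v show ?case
      by (auto simp: t join_def semicomplete_def irrefl_def)
  next
    case (3 E)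
    then show ?case
      by (auto simp: join_def semicomplete_def total_on_def irrefl_def) (metis v)
  next
    case (4 E)
    then show ?case
      using semicomplete_restrict[of E "insert v V" V] by (auto simp: I_def)
  next
    case (5 t)
    obtain E X Z where t: "t = (E, X, Z)" by (cases t)
    with 5 have *: "E \<subseteq> V \<times> V" "X \<subseteq> V" "Z \<subseteq> X"
      by (auto simp: I_def semicomplete_def)
    have mem: "(i, j) \<in> join t \<and> (j, i) \<in> join t \<and> i \<noteq> j \<longleftrightarrow>
        (i, j) \<in> E \<and> (j, i) \<in> E \<and> i \<noteq> j \<or> i = v \<and> j \<in> Z \<or> j = v \<and> i \<in> Z" for i j
      using * v by (auto simp: t join_def)
    have "ties (join t) = ties E \<union> (\<lambda>u. {u, v}) ` Z"
    proof (rule set_eqI)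
      fix S
      have "S \<in> ties (join t) \<longleftrightarrow> (\<exists>i j. S = {i, j} \<and> ((i, j) \<in> join t \<and> (j, i) \<in> join t \<and> i \<noteq> j))"
        by (auto simp: ties_def)
      also have "\<dots> \<longleftrightarrow> S \<in> ties E \<union> (\<lambda>u. {u, v}) ` Z"
        unfolding mem by (auto simp: ties_def)
      finally show "S \<in> ties (join t) \<longleftrightarrow> S \<in> ties E \<union> (\<lambda>u. {u, v}) ` Z" .
    qed
    moreover have "ties E \<inter> (\<lambda>u. {u, v}) ` Z = {}"
      using ties_subset[OF *(1)] v by auto
    moreover have "inj_on (\<lambda>u. {u, v}) Z"
      by (auto simp: inj_on_def doubleton_eq_iff)
    ultimately have "card (ties (join t)) = card (ties E) + card Z"
      using finite_ties[OF V *(1)] finite_subset[OF _ V, of Z] *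
      by (simp add: card_Un_disjoint card_image)
    then show ?case by (simp add: t)
  qed
  finally show ?thesis by (simp add: total_weight_def)
qed

lemma total_weight_eq:
  assumes "finite V"
  shows "total_weight c V = (c + 2) ^ (card V choose 2)"
  using assms
proof induction
  case (insert v V)
  then show ?case
    by (simp add: total_weight_insert numeral_2_eq_2 power_add mult.commute)
qed (simp add: numeral_2_eq_2)

text \<open>The product rule for exponential generating functions: grouping the subsets by size
  \<open>k\<close> produces a binomial coefficient, whose factorials cancel against the
  normalisation.\<close>

lemma sum_Pow_egf:
  fixes F G :: "real fps"
  assumes "finite V"
  shows "(\<Sum>A\<in>Pow V. (fact (card A) * F $ card A) * (fact (card (V - A)) * G $ card (V - A))) =
    fact (card V) * (F * G) $ card V"
proof -
  let ?n = "card V"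
  have "(\<Sum>A\<in>Pow V. (fact (card A) * F $ card A) * (fact (card (V - A)) * G $ card (V - A))) =
      (\<Sum>A\<in>Pow V. (fact (card A) * F $ card A) * (fact (?n - card A) * G $ (?n - card A)))"
    using assms by (intro sum.cong refl) (auto simp: card_Diff_subset finite_subset)
  also have "\<dots> = (\<Sum>k\<in>{0..?n}. of_nat (card {A \<in> Pow V. card A = k}) *
      ((fact k * F $ k) * (fact (?n - k) * G $ (?n - k))))"
    using assms by (intro sum_fun_comp) (auto intro: card_mono)
  also have "\<dots> = (\<Sum>k\<in>{0..?n}. fact ?n * (F $ k * G $ (?n - k)))"
  proof (intro sum.cong refl)
    fix k assume "k \<in> {0..?n}"
    then have fact_eq: "real (?n choose k) * (fact k * fact (?n - k)) = fact ?n"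
      using binomial_fact_lemma[of k ?n] by (metis atLeastAtMost_iff mult.commute of_nat_fact of_nat_mult)
    show "of_nat (card {A \<in> Pow V. card A = k}) * ((fact k * F $ k) * (fact (?n - k) * G $ (?n - k)))
       = fact ?n * (F $ k * G $ (?n - k))"
      using n_subsets[OF assms, of k] by (simp add: mult_ac flip: fact_eq)
  qed
  finally show ?thesis by (simp add: fps_mult_nth sum_distrib_left)
qed

section \<open>Generating functions of all and of strongly connected relations\<close>

definition total_egf :: "real \<Rightarrow> real fps" where
  "total_egf c = Abs_fps (\<lambda>n. (c + 2) ^ (n choose 2) / fact n)"

text \<open>The solution of \<open>S * T = T - 1\<close>, the generating function form of the
  first-component recurrence. That it counts strongly connected relations is
  \<open>class_weight_1_egf\<close>.\<close>

definition strong_egf :: "real \<Rightarrow> real fps" where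
  "strong_egf c = 1 - inverse (total_egf c)"

lemma total_egf_nth_0 [simp]: "total_egf c $ 0 = 1"
  by (simp add: total_egf_def numeral_2_eq_2)

lemma strong_egf_nth_0 [simp]: "strong_egf c $ 0 = 0"
  by (simp add: strong_egf_def)

lemma strong_egf_times_total_egf: "strong_egf c * total_egf c = total_egf c - 1"
  by (simp add: strong_egf_def algebra_simps inverse_mult_eq_1')

lemma class_weight_empty: "class_weight c m {} = (if m = 0 then 1 else 0)"
proof -
  have "{E. E \<in> semicomplete ({} :: 'a set) \<and> num_classes {} E = m} = (if m = 0 then {{}} else {})"
    by (auto simp: num_classes_def)
  then show "class_weight c m ({} :: 'a set) = (if m = 0 then 1 else 0)"
    by (simp add: class_weight_def)
qed

lemma class_weight_0:
  assumes "finite V" "V \<noteq> {}"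
  shows "class_weight c 0 V = 0"
  using assms by (simp add: class_weight_def num_classes_def)

text \<open>Both sides satisfy the same recurrence against \<open>total_weight\<close>. Its term for
  \<open>A = V\<close> has the factor \<open>total_weight c {} = 1\<close>, so the value at
  \<open>V\<close> is determined by the values at proper subsets.\<close>

lemma class_weight_1_egf:
  assumes "finite V"
  shows "class_weight c 1 V = fact (card V) * strong_egf c $ card V"
  using assms
proof (induction V rule: finite_psubset_induct)
  case (psubset V)
  let ?S = "\<lambda>A. fact (card A) * strong_egf c $ card A" and ?T = "total_weight c"
  have T: "?T A = fact (card A) * total_egf c $ card A" if "A \<subseteq> V" for A
    using total_weight_eq[of A c] finite_subset[OF that psubset.hyps] by (simp add: total_egf_def)
  show ?case
  proof (cases "V = {}")
    case True
    then show ?thesis by (simp add: class_weight_empty)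
  next
    case False
    have *: "(\<Sum>A\<in>Pow V. f A * ?T (V - A)) = f V + (\<Sum>A\<in>Pow V - {V}. f A * ?T (V - A))" for f
      using psubset.hyps by (subst sum.remove[of _ V]) auto
    have "class_weight c 1 V + (\<Sum>A\<in>Pow V - {V}. class_weight c 1 A * ?T (V - A)) = ?T V"
      by (rule trans[OF *[of "class_weight c 1", symmetric]
          total_weight_first_component[OF psubset.hyps False, symmetric]])
    moreover have "(\<Sum>A\<in>Pow V - {V}. class_weight c 1 A * ?T (V - A)) =
        (\<Sum>A\<in>Pow V - {V}. ?S A * ?T (V - A))"
      using psubset.IH by (intro sum.cong) auto
    moreover have "?S V + (\<Sum>A\<in>Pow V - {V}. ?S A * ?T (V - A)) = (\<Sum>A\<in>Pow V. ?S A * ?T (V - A))"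
      by (rule *[of ?S, symmetric])
    moreover have "(\<Sum>A\<in>Pow V. ?S A * ?T (V - A)) = fact (card V) * (strong_egf c * total_egf c) $ card V"
      using T by (subst sum_Pow_egf[OF psubset.hyps, symmetric]) (intro sum.cong, auto)
    moreover have "fact (card V) * (strong_egf c * total_egf c) $ card V = ?T V"
      using T[of V] False psubset.hyps by (simp add: strong_egf_times_total_egf)
    ultimately show ?thesis by linarith
  qed
qed

lemma class_weight_egf:
  assumes "finite V"
  shows "class_weight c m V = fact (card V) * (strong_egf c ^ m) $ card V"
  using assms
proof (induction m arbitrary: V)
  case 0
  then show ?case
    by (cases "V = {}") (auto simp: class_weight_empty class_weight_0)
next
  case (Suc m)
  show ?case
  proof (cases "V = {}")
    case True
    then show ?thesis by (simp add: class_weight_empty)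
  next
    case False
    have "class_weight c (Suc m) V = (\<Sum>A\<in>Pow V. (fact (card A) * strong_egf c $ card A) *
        (fact (card (V - A)) * (strong_egf c ^ m) $ card (V - A)))"
      unfolding class_weight_Suc[OF Suc.prems False]
      using Suc by (intro sum.cong refl arg_cong2[of _ _ _ _ "(*)"] class_weight_1_egf Suc.IH)
        (auto intro: finite_subset)
    then show ?thesis
      by (simp add: sum_Pow_egf[OF Suc.prems])
  qed
qed

section \<open>Transfer to digraphs on \<open>{1..n}\<close>\<close>

lemma tournament_with_ties_iff:
  "tournament_with_ties n T \<longleftrightarrow> pverts T = {1..n} \<and> parcs T \<in> semicomplete {1..n}"
proof
  assume T: "tournament_with_ties n T"
  then interpret pair_digraph T by (simp add: tournament_with_ties_def)
  have V: "pverts T = {1..n}" and tot: "total_on {1..n} (parcs T)"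
    using T by (auto simp: tournament_with_ties_def total_on_def)
  have "parcs T \<subseteq> {1..n} \<times> {1..n}"
    using in_arcsD1 in_arcsD2 V by auto
  moreover have "irrefl (parcs T)"
    using no_loops' by (auto simp: irrefl_def)
  ultimately show "pverts T = {1..n} \<and> parcs T \<in> semicomplete {1..n}"
    using V tot by (simp add: semicomplete_def)
next
  assume *: "pverts T = {1..n} \<and> parcs T \<in> semicomplete {1..n}"
  then have "finite (parcs T)"
    by (auto simp: semicomplete_def intro: finite_subset)
  with * have "pair_digraph T"
    by unfold_locales (auto simp: semicomplete_def irrefl_def)
  with * show "tournament_with_ties n T"
    by (auto simp: tournament_with_ties_def semicomplete_def total_on_def)
qed

text \<open>Reachability in a digraph is reflexive on its vertices only, whereas the closure of
  \<open>parcs T\<close> is reflexive everywhere. For walks that start at a vertex the two notions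
  agree.\<close>

lemma num_sccs_eq_num_classes:
  assumes "tournament_with_ties n T"
  shows "num_sccs T = num_classes {1..n} (parcs T)"
proof -
  from assms interpret pair_digraph T by (simp add: tournament_with_ties_def)
  have V: "pverts T = {1..n}" and sub: "parcs T \<subseteq> {1..n} \<times> {1..n}"
    using assms by (auto simp: tournament_with_ties_iff semicomplete_def)
  have reach: "u \<rightarrow>\<^sup>*\<^bsub>with_proj T\<^esub> v \<longleftrightarrow> (u, v) \<in> (parcs T)\<^sup>*" if "u \<in> {1..n}" for u v
  proof
    show "(u, v) \<in> (parcs T)\<^sup>*" if "u \<rightarrow>\<^sup>*\<^bsub>with_proj T\<^esub> v"
      using that unfolding reachable_def by (auto intro: rtrancl_on_rtranclI simp: arcs_ends_conv)
    show "u \<rightarrow>\<^sup>*\<^bsub>with_proj T\<^esub> v" if "(u, v) \<in> (parcs T)\<^sup>*"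
      using that
    proof induction
      case (step y z)
      then show ?case
        by (meson in_arcsD1 reachable_adj_trans with_proj_simps)
    qed (use \<open>u \<in> {1..n}\<close> V in auto)
  qed
  have "num_sccs T = card (scc_of ` {1..n})"
    using V by (simp add: num_sccs_def sccs_verts_conv_scc_of flip: card_sccs_verts)
  also have "scc_of ` {1..n} = strong_class (parcs T) ` {1..n}"
  proof (intro image_cong refl)
    fix u assume u: "u \<in> {1..n}"
    \<comment> \<open>\<open>reach\<close> wants a vertex as starting point; \<open>v\<close> is one
      because it is reached from \<open>u\<close>.\<close>
    have "v \<rightarrow>\<^sup>*\<^bsub>with_proj T\<^esub> u \<longleftrightarrow> (v, u) \<in> (parcs T)\<^sup>*" if "(u, v) \<in> (parcs T)\<^sup>*" for v
      using rtrancl_within[OF sub that u] by (rule reach)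
    then show "scc_of u = strong_class (parcs T) u"
      unfolding scc_of_def strong_class_def using reach[OF u] by auto
  qed
  finally show ?thesis by (simp add: num_classes_def)
qed

lemma tie_weight_eq: "tie_weight \<rho> T = (\<rho> - 1) ^ card (ties (parcs T))"
  by (simp add: tie_weight_def tied_pairs_def ties_def)

lemma it_eq: "it \<rho> n = fact n * total_egf (\<rho> - 1) $ n"
proof -
  have "it \<rho> n = total_weight (\<rho> - 1) {1..n}"
    unfolding it_def total_weight_def
    by (rule sum.reindex_bij_witness[of _ "\<lambda>E. \<lparr>pverts = {1..n}, parcs = E\<rparr>" parcs])
      (auto simp: tournament_with_ties_iff tie_weight_eq)
  then show ?thesis by (simp add: total_weight_eq total_egf_def)
qed

lemma it_sccs_eq: "it_sccs \<rho> m n = fact n * (strong_egf (\<rho> - 1) ^ m) $ n"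
proof -
  have "it_sccs \<rho> m n = class_weight (\<rho> - 1) m {1..n}"
    unfolding it_sccs_def class_weight_def
    by (rule sum.reindex_bij_witness[of _ "\<lambda>E. \<lparr>pverts = {1..n}, parcs = E\<rparr>" parcs])
      (auto simp: tournament_with_ties_iff tie_weight_eq num_sccs_eq_num_classes[of n, unfolded tournament_with_ties_iff])
  then show ?thesis by (simp add: class_weight_egf)
qed

section \<open>Expansions in a rapidly growing scale\<close>

locale rapid_growth =
  fixes q :: real
  assumes q_pos: "0 < q" and q_less_1: "q < 1"
begin

text \<open>The coefficients of \<open>total_egf c\<close> when
  \<open>c + 2 = inverse q\<close>.\<close>

definition a :: "nat \<Rightarrow> real" where
  "a n = inverse q ^ (n choose 2) / fact n"

definition A :: "real fps" where
  "A = Abs_fps a"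

lemma A_nth [simp]: "A $ n = a n"
  by (simp add: A_def)

lemma a_pos: "a n > 0"
  using q_pos by (simp add: a_def)

lemma a_0 [simp]: "a 0 = 1"
  by (simp add: a_def numeral_2_eq_2)

lemma a_Suc: "a n = a (Suc n) * (real (Suc n) * q ^ n)"
proof -
  have "Suc n choose 2 = n + (n choose 2)"
    by (simp add: numeral_2_eq_2)
  then show ?thesis
    using q_pos by (simp add: a_def power_add field_simps del: of_nat_Suc)
qed

text \<open>Rests on \<open>(i + j choose 2) = (i choose 2) + (j choose 2) + i * j\<close>. The
  factor \<open>q ^ (i * j)\<close> is the reason why the extreme terms dominate a
  convolution.\<close>

lemma a_add: "a i * a j = a (i + j) * (real (i + j choose i) * q ^ (i * j))"
proof (induction i)
  case (Suc i)
  have eq: "real (Suc (i + j)) * real (i + j choose i) = real (Suc i) * real (Suc (i + j) choose Suc i)"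
    using Suc_times_binomial_eq[of "i + j" i] by (metis mult.commute of_nat_mult)
  have "a (Suc i) * a j * (real (Suc i) * q ^ i) = a i * a j"
    using a_Suc[of i] by (simp add: mult_ac)
  also have "\<dots> = a (Suc (i + j)) * (real (Suc (i + j)) * q ^ (i + j)) * (real (i + j choose i) * q ^ (i * j))"
    using Suc a_Suc[of "i + j"] by simp
  also have "\<dots> = a (Suc (i + j)) * (real (Suc (i + j)) * real (i + j choose i)) * (q ^ (i + j) * q ^ (i * j))"
    by (simp only: mult_ac)
  also have "\<dots> = a (Suc (i + j)) * (real (Suc i) * real (Suc (i + j) choose Suc i)) * (q ^ (i + j) * q ^ (i * j))"
    by (simp only: eq)
  also have "\<dots> = a (Suc i + j) * (real (Suc i + j choose Suc i) * q ^ (Suc i * j)) * (real (Suc i) * q ^ i)"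
    by (simp add: power_add mult_ac)
  finally show ?case
    using q_pos by (simp del: of_nat_Suc)
qed simp

text \<open>The remainder terms of order \<open>s\<close>. Truncated subtraction affects only the
  finitely many \<open>n < s\<close>.\<close>

definition O_shift :: "nat \<Rightarrow> real fps set" where
  "O_shift s = {F. (\<lambda>n. F $ n) \<in> O(\<lambda>n. a (n - s))}"

lemma O_shift_iff: "F \<in> O_shift s \<longleftrightarrow> (\<lambda>n. fps_nth F n) \<in> O(\<lambda>n. a (n - s))"
  by (simp add: O_shift_def)

text \<open>The ratio of neighbouring coefficients \<open>a n / a (Suc n)\<close> is
  \<open>Suc n * q ^ n\<close>, which tends to 0.\<close>

lemma a_shift_smallo: "(\<lambda>n. a (n - Suc s)) \<in> o(\<lambda>n. a (n - s))"
proof (rule smalloI_tendsto)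
  have "(\<lambda>n. real (Suc n) * q ^ n) \<longlonglongrightarrow> 0"
    using q_pos q_less_1 by real_asymp
  then have "filterlim (\<lambda>n. real (Suc (n - Suc s)) * q ^ (n - Suc s)) (nhds 0) sequentially"
    by (rule filterlim_compose) (rule filterlim_minus_const_nat_at_top)
  moreover have "eventually (\<lambda>n. real (Suc (n - Suc s)) * q ^ (n - Suc s) = a (n - Suc s) / a (n - s)) sequentially"
    using eventually_gt_at_top[of s]
  proof eventually_elim
    case (elim n)
    then have "Suc (n - Suc s) = n - s" by simp
    then show ?case
      using a_Suc[of "n - Suc s"] a_pos[of "n - s"] by (simp add: field_simps del: of_nat_Suc)
  qed
  ultimately show "(\<lambda>n. a (n - Suc s) / a (n - s)) \<longlonglongrightarrow> 0"
    by (rule Lim_transform_eventually)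
  show "eventually (\<lambda>n. a (n - s) \<noteq> 0) sequentially"
    using a_pos by (intro always_eventually allI) (simp add: less_imp_neq[symmetric])
qed

lemma a_shift_mono: "s \<le> t \<Longrightarrow> (\<lambda>n. a (n - t)) \<in> O(\<lambda>n. a (n - s))"
proof (induction rule: dec_induct)
  case (step t)
  then show ?case
    using landau_o.small_imp_big[OF a_shift_smallo[of t]] landau_o.big_trans by blast
qed simp

lemma O_shift_mono: "s \<le> t \<Longrightarrow> F \<in> O_shift t \<Longrightarrow> F \<in> O_shift s"
  unfolding O_shift_def using a_shift_mono landau_o.big_trans by blast

lemma O_shift_add: "F \<in> O_shift s \<Longrightarrow> G \<in> O_shift s \<Longrightarrow> F + G \<in> O_shift s"
  using sum_in_bigo[of "\<lambda>n. F $ n" _ "\<lambda>n. a (n - s)" "\<lambda>n. G $ n"] by (simp add: O_shift_iff)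

lemma O_shift_diff: "F \<in> O_shift s \<Longrightarrow> G \<in> O_shift s \<Longrightarrow> F - G \<in> O_shift s"
  using sum_in_bigo[of "\<lambda>n. F $ n" _ "\<lambda>n. a (n - s)" "\<lambda>n. G $ n"] by (simp add: O_shift_iff)

lemma O_shift_const_mult: "F \<in> O_shift s \<Longrightarrow> fps_const c * F \<in> O_shift s"
  using landau_o.big.cmult_in_iff[of c] by (cases "c = 0") (simp_all add: O_shift_iff)

lemma O_shift_finite_support:
  assumes "\<And>n. n \<ge> N \<Longrightarrow> F $ n = 0"
  shows "F \<in> O_shift s"
proof -
  have "eventually (\<lambda>n. F $ n = 0) sequentially"
    using assms eventually_at_top_linorder by blast
  then show ?thesis
    unfolding O_shift_def using landau_o.big.in_cong[of "\<lambda>n. F $ n" "\<lambda>_. 0"] by simp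
qed

lemma O_shift_X_power_mult:
  assumes "F \<in> O_shift s"
  shows "fps_X ^ i * F \<in> O_shift (s + i)"
proof -
  have "(\<lambda>n. F $ (n - i)) \<in> O(\<lambda>n. a (n - i - s))"
    using assms unfolding O_shift_def mem_Collect_eq
    by (rule landau_o.big.compose) (rule filterlim_minus_const_nat_at_top)
  moreover have "eventually (\<lambda>n. (fps_X ^ i * F) $ n = F $ (n - i)) sequentially"
    using eventually_ge_at_top[of i] by eventually_elim (simp add: fps_X_power_mult_nth)
  then have "(\<lambda>n. (fps_X ^ i * F) $ n) \<in> O(\<lambda>n. a (n - i - s)) \<longleftrightarrow> (\<lambda>n. F $ (n - i)) \<in> O(\<lambda>n. a (n - i - s))"
    by (rule landau_o.big.in_cong)
  ultimately show ?thesis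
    unfolding O_shift_def by (simp add: add.commute)
qed

text \<open>All \<open>a n\<close> are positive, so the finitely many exceptional indices can be
  absorbed into the constant.\<close>

lemma O_shift_0_bound:
  assumes "F \<in> O_shift 0"
  obtains C where "C \<ge> 0" "\<And>n. \<bar>F $ n\<bar> \<le> C * a n"
proof -
  from assms obtain c where c: "eventually (\<lambda>n. \<bar>F $ n\<bar> \<le> c * a n) sequentially"
    unfolding O_shift_def using a_pos by (auto simp: bigo_def less_imp_le abs_of_pos)
  then obtain N where N: "\<And>n. n \<ge> N \<Longrightarrow> \<bar>F $ n\<bar> \<le> c * a n"
    by (auto simp: eventually_at_top_linorder)
  define C where "C = \<bar>c\<bar> + (\<Sum>n<N. \<bar>F $ n\<bar> / a n)"
  have nonneg: "\<bar>F $ n\<bar> / a n \<ge> 0" for n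
    using a_pos[of n] by simp
  then have s: "(\<Sum>n<N. \<bar>F $ n\<bar> / a n) \<ge> 0" by (intro sum_nonneg)
  have "\<bar>F $ n\<bar> \<le> C * a n" for n
  proof (cases "n < N")
    case True
    then have "\<bar>F $ n\<bar> / a n \<le> (\<Sum>n<N. \<bar>F $ n\<bar> / a n)"
      using nonneg by (intro member_le_sum) auto
    then have "\<bar>F $ n\<bar> / a n \<le> C" by (simp add: C_def)
    then show ?thesis using a_pos[of n] by (simp add: field_simps)
  next
    case False
    have "c \<le> C" using s by (simp add: C_def)
    then have "c * a n \<le> C * a n" using a_pos[of n] by simp
    with N[of n] False show ?thesis by simp
  qed
  moreover have "C \<ge> 0" using s by (simp add: C_def)
  ultimately show thesis using that by blast
qed

text \<open>Here \<open>n choose i \<le> 2 ^ n\<close> suffices, because \<open>i * (n - i) \<ge> R * (n - R)\<close> between the cut-offs.\<close>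

lemma O_shift_tails_mult:
  assumes F: "F \<in> O_shift 0" and G: "G \<in> O_shift 0" and R: "2 * q ^ R \<le> q ^ s"
  shows "(F - fps_cutoff R F) * (G - fps_cutoff R G) \<in> O_shift s"
proof -
  obtain C where C: "C \<ge> 0" "\<And>n. \<bar>F $ n\<bar> \<le> C * a n" using O_shift_0_bound[OF F] by blast
  obtain D where D: "D \<ge> 0" "\<And>n. \<bar>G $ n\<bar> \<le> D * a n" using O_shift_0_bound[OF G] by blast
  let ?F = "F - fps_cutoff R F" and ?G = "G - fps_cutoff R G"
  have bound: "\<bar>(?F * ?G) $ n\<bar> \<le> C * D * inverse (q ^ (R * R)) * a s * a (n - s)" if n: "n \<ge> R" "n \<ge> s" for n
  proof -
    have "\<bar>?F $ i * ?G $ (n - i)\<bar> \<le> C * D * (a n * q ^ (R * (n - R))) * real (n choose i)"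
      if i: "i \<le> n" for i
    proof (cases "R \<le> i \<and> R \<le> n - i")
      case True
      obtain x y where xy: "i = R + x" "n - i = R + y" using True by (metis le_add_diff_inverse)
      then have "n - R = R + x + y" using i by linarith
      moreover have "R * (R + x + y) \<le> (R + x) * (R + y)"
        by (simp add: algebra_simps)
      ultimately have "R * (n - R) \<le> i * (n - i)"
        using xy by metis
      then have le: "q ^ (i * (n - i)) \<le> q ^ (R * (n - R))"
        using q_pos q_less_1 by (intro power_decreasing) auto
      have "\<bar>?F $ i * ?G $ (n - i)\<bar> \<le> \<bar>F $ i\<bar> * \<bar>G $ (n - i)\<bar>"
        using True by (simp add: abs_mult)
      also have "\<dots> \<le> (C * a i) * (D * a (n - i))"
        using C D a_pos[of i] by (intro mult_mono) auto
      also have "\<dots> = C * D * (a n * (real (n choose i) * q ^ (i * (n - i))))"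
        using a_add[of i "n - i"] i by (simp add: mult_ac)
      also have "\<dots> \<le> C * D * (a n * (real (n choose i) * q ^ (R * (n - R))))"
        using C D a_pos[of n] le by (intro mult_left_mono) auto
      finally show ?thesis by (simp add: mult_ac)
    next
      case False
      then have "?F $ i * ?G $ (n - i) = 0" by auto
      moreover have "0 \<le> C * D * (a n * q ^ (R * (n - R))) * real (n choose i)"
        using C D a_pos[of n] q_pos by simp
      ultimately show ?thesis by linarith
    qed
    then have "\<bar>(?F * ?G) $ n\<bar> \<le> (\<Sum>i=0..n. C * D * (a n * q ^ (R * (n - R))) * real (n choose i))"
      unfolding fps_mult_nth by (intro order_trans[OF sum_abs] sum_mono) auto
    also have "\<dots> = C * D * (a n * q ^ (R * (n - R))) * real (\<Sum>i\<le>n. n choose i)"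
      by (simp add: sum_distrib_left atLeast0AtMost)
    also have "\<dots> = C * D * inverse (q ^ (R * R)) * (a n * (2 * q ^ R) ^ n)"
    proof -
      have "R * n = R * (n - R) + R * R"
        using n by (simp flip: distrib_left)
      then have "(q ^ R) ^ n = q ^ (R * (n - R)) * q ^ (R * R)"
        by (simp flip: power_mult power_add)
      then show ?thesis
        using q_pos by (simp add: choose_row_sum power_mult_distrib)
    qed
    \<comment> \<open>Here \<open>R\<close> pays for the factor \<open>2 ^ n\<close>: by hypothesis
      \<open>2 * q ^ R\<close> is at most \<open>q ^ s\<close>, and \<open>a_add\<close> at
      \<open>s\<close> and \<open>n - s\<close> then produces \<open>a (n - s)\<close>.\<close>
    also have "\<dots> \<le> C * D * inverse (q ^ (R * R)) * (a s * a (n - s))"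
    proof (intro mult_left_mono)
      have "s * n = s * (n - s) + s * s"
        using n by (simp flip: distrib_left)
      then have "s * (n - s) \<le> s * n" by simp
      have "(2 * q ^ R) ^ n \<le> (q ^ s) ^ n"
        using R q_pos by (intro power_mono) auto
      also have "\<dots> \<le> q ^ (s * (n - s))"
        using \<open>s * (n - s) \<le> s * n\<close> q_pos q_less_1
        by (simp flip: power_mult)
      also have "\<dots> \<le> real (n choose s) * q ^ (s * (n - s))"
      proof -
        have "1 \<le> n choose s" using n by (simp add: Suc_leI zero_less_binomial)
        then have "1 \<le> real (n choose s)" by linarith
        from mult_right_mono[OF this, of "q ^ (s * (n - s))"] show ?thesis
          using q_pos by simp
      qed
      finally have "a n * (2 * q ^ R) ^ n \<le> a n * (real (n choose s) * q ^ (s * (n - s)))"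
        using a_pos[of n] by simp
      then show "a n * (2 * q ^ R) ^ n \<le> a s * a (n - s)"
        using a_add[of s "n - s"] n by simp
    qed (use C D q_pos in auto)
    finally show ?thesis by (simp add: mult_ac)
  qed
  have "eventually (\<lambda>n. norm ((?F * ?G) $ n) \<le> (C * D * inverse (q ^ (R * R)) * a s) * norm (a (n - s))) sequentially"
    using eventually_ge_at_top[of "max R s"]
  proof eventually_elim
    case (elim n)
    then show ?case using bound[of n] a_pos[of "n - s"] by simp
  qed
  then show ?thesis unfolding O_shift_def mem_Collect_eq by (rule bigoI)
qed

section \<open>Calculus of expansions\<close>

text \<open>States that \<open>F $ n\<close> is the sum of \<open>D $ k * a (n - k)\<close> over
  \<open>k < s\<close>, up to \<open>O(a (n - s))\<close>. Writing the sum as a polynomial times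
  \<open>A\<close> makes ring identities available.\<close>

definition expansion :: "nat \<Rightarrow> real fps \<Rightarrow> real fps \<Rightarrow> bool" where
  "expansion s F D \<longleftrightarrow> F - fps_cutoff s D * A \<in> O_shift s"

lemma expansion_cong:
  assumes "expansion s F D" "\<And>k. k < s \<Longrightarrow> D $ k = E $ k"
  shows "expansion s F E"
proof -
  have "fps_cutoff s D = fps_cutoff s E" using assms(2) by (simp add: fps_cutoff_eq_fps_cutoff_iff)
  with assms(1) show ?thesis by (simp add: expansion_def)
qed

lemma expansion_0: "expansion 0 F D \<longleftrightarrow> F \<in> O_shift 0"
  by (simp add: expansion_def)

lemma expansion_zero_right: "expansion s F 0 \<longleftrightarrow> F \<in> O_shift s"
  by (simp add: expansion_def)

lemma expansion_add:
  assumes "expansion s F D" "expansion s G E"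
  shows "expansion s (F + G) (D + E)"
proof -
  have "F + G - fps_cutoff s (D + E) * A = (F - fps_cutoff s D * A) + (G - fps_cutoff s E * A)"
    by (simp add: fps_cutoff_add algebra_simps)
  then show ?thesis
    using assms unfolding expansion_def by (simp only: O_shift_add)
qed

lemma expansion_diff:
  assumes "expansion s F D" "expansion s G E"
  shows "expansion s (F - G) (D - E)"
proof -
  have "F - G - fps_cutoff s (D - E) * A = (F - fps_cutoff s D * A) - (G - fps_cutoff s E * A)"
    by (simp add: fps_cutoff_diff algebra_simps)
  then show ?thesis
    using assms unfolding expansion_def by (simp only: O_shift_diff)
qed

lemma expansion_const_mult:
  assumes "expansion s F D"
  shows "expansion s (fps_const c * F) (fps_const c * D)"
proof -
  have "fps_cutoff s (fps_const c * D) = fps_const c * fps_cutoff s D"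
    by (rule fps_ext) simp
  then show ?thesis
    using O_shift_const_mult[of "F - fps_cutoff s D * A" s c] assms unfolding expansion_def
    by (simp add: right_diff_distrib mult.assoc)
qed

lemma fps_cutoff_Suc: "fps_cutoff (Suc N) P = fps_cutoff N P + fps_const (P $ N) * fps_X ^ N"
  for P :: "real fps"
  by (rule fps_ext) (auto simp: less_Suc_eq)

text \<open>Follows by linearity from monomials. Only monomials that occur in \<open>P\<close> are
  constrained, so that vanishing low coefficients can be exploited.\<close>

lemma expansion_cutoff_mult:
  assumes "\<And>k. k < N \<Longrightarrow> P $ k \<noteq> 0 \<Longrightarrow> expansion s (fps_X ^ k * F) (fps_X ^ k * D)"
  shows "expansion s (fps_cutoff N P * F) (fps_cutoff N P * D)"
  using assms
proof (induction N)
  case 0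
  have "(0 :: real fps) \<in> O_shift s" by (rule O_shift_finite_support[of 0]) simp
  then show ?case by (simp add: expansion_zero_right)
next
  case (Suc N)
  show ?case
  proof (cases "P $ N = 0")
    case True
    then show ?thesis using Suc by (simp add: fps_cutoff_Suc)
  next
    case False
    have "expansion s (fps_cutoff N P * F + fps_const (P $ N) * (fps_X ^ N * F))
        (fps_cutoff N P * D + fps_const (P $ N) * (fps_X ^ N * D))"
      using Suc False by (intro expansion_add expansion_const_mult) auto
    then show ?thesis by (simp add: fps_cutoff_Suc distrib_right mult.assoc)
  qed
qed

lemma A_in_O_shift: "A \<in> O_shift 0"
  by (simp add: O_shift_iff)

text \<open>The terms of \<open>D\<close> from order \<open>s\<close> up to \<open>t\<close> have
  the form \<open>fps_X ^ k * A\<close> with \<open>k \<ge> s\<close>, up to constants, and are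
  absorbed by the remainder.\<close>

lemma expansion_mono:
  assumes "expansion t F D" "s \<le> t"
  shows "expansion s F D"
proof -
  have "fps_X ^ k * A \<in> O_shift s" if "(D - fps_cutoff s D) $ k \<noteq> 0" for k
  proof -
    have "s \<le> k" using that by (auto split: if_splits)
    then show ?thesis
      using O_shift_mono O_shift_X_power_mult[OF A_in_O_shift, of k] by simp
  qed
  then have "fps_cutoff t (D - fps_cutoff s D) * A \<in> O_shift s"
    using expansion_cutoff_mult[of t "D - fps_cutoff s D" s A 0] by (simp add: expansion_zero_right)
  moreover have "F - fps_cutoff t D * A \<in> O_shift s"
    using assms O_shift_mono unfolding expansion_def by blast
  moreover have "fps_cutoff t D = fps_cutoff s D + fps_cutoff t (D - fps_cutoff s D)"
    using assms(2) by (intro fps_ext) auto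
  then have "F - fps_cutoff s D * A = (F - fps_cutoff t D * A) + fps_cutoff t (D - fps_cutoff s D) * A"
    by (simp only: distrib_right) simp
  ultimately show ?thesis
    unfolding expansion_def by (simp only: O_shift_add)
qed

lemma expansion_X_power_mult:
  assumes "expansion s F D"
  shows "expansion (s + k) (fps_X ^ k * F) (fps_X ^ k * D)"
proof -
  have "fps_cutoff (s + k) (fps_X ^ k * D) = fps_X ^ k * fps_cutoff s D"
    by (rule fps_ext) (auto simp: fps_X_power_mult_nth)
  then show ?thesis
    using O_shift_X_power_mult[of "F - fps_cutoff s D * A" s k] assms unfolding expansion_def
    by (simp add: right_diff_distrib mult.assoc)
qed

text \<open>The second hypothesis is weaker than \<open>expansion s G E\<close> when \<open>F $ 0 = 0\<close>; this lets
  \<open>expansion_inverse\<close> gain one order per induction step.\<close>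

lemma expansion_mult_gen:
  assumes F: "expansion s F D" and G: "\<And>k. F $ k \<noteq> 0 \<Longrightarrow> expansion s (fps_X ^ k * G) (fps_X ^ k * E)"
    and G0: "G \<in> O_shift 0"
  shows "expansion s (F * G) (F * E + G * D)"
proof -
  have F0: "F \<in> O_shift 0" using expansion_mono[OF F, of 0] by (simp add: expansion_0)
  have "(\<lambda>r. q ^ r) \<longlonglongrightarrow> 0" using q_pos q_less_1 by (intro LIMSEQ_power_zero) auto
  then have "eventually (\<lambda>r. q ^ r < 1 / 2) sequentially" by (rule order_tendstoD) simp
  then obtain r where r: "q ^ r < 1 / 2" by (auto simp: eventually_at_top_linorder)
  \<comment> \<open>The summand \<open>r\<close> yields \<open>2 * q ^ R \<le> q ^ s\<close>. The
    summand \<open>s\<close> ensures that cutting off at \<open>R\<close> leaves the coefficients of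
    \<open>F * E + G * D\<close> below \<open>s\<close> unchanged.\<close>
  define R where "R = s + r"
  let ?F = "fps_cutoff R F" and ?G = "fps_cutoff R G"
  have "2 * q ^ R \<le> q ^ s"
    using r q_pos by (simp add: R_def power_add)
  then have tails: "expansion s ((F - ?F) * (G - ?G)) 0"
    unfolding expansion_zero_right by (rule O_shift_tails_mult[OF F0 G0])
  have "(?F * ?G) $ n = 0" if "n \<ge> 2 * R" for n
    unfolding fps_mult_nth using that by (intro sum.neutral) auto
  then have heads: "expansion s (?F * ?G) 0"
    unfolding expansion_zero_right by (rule O_shift_finite_support)
  have "expansion s (?F * G) (?F * E)"
    using G by (rule expansion_cutoff_mult)
  moreover have "expansion s (?G * F) (?G * D)"
    by (intro expansion_cutoff_mult expansion_mono[OF expansion_X_power_mult[OF F]]) simp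
  \<comment> \<open>Inclusion-exclusion: each head times the other full series gives a main term;
    the product of the heads, counted twice, is a polynomial, and the product of the tails is
    negligible.\<close>
  ultimately have "expansion s (?F * G + ?G * F - ?F * ?G + (F - ?F) * (G - ?G)) (?F * E + ?G * D - 0 + 0)"
    using heads tails by (intro expansion_add expansion_diff)
  moreover have "?F * G + ?G * F - ?F * ?G + (F - ?F) * (G - ?G) = F * G"
    by (simp add: algebra_simps)
  ultimately have "expansion s (F * G) (?F * E + ?G * D)" by simp
  then show ?thesis
    by (rule expansion_cong) (simp add: fps_cutoff_left_mult_nth R_def)
qed

text \<open>The Leibniz rule.\<close>

lemma expansion_mult:
  assumes F: "expansion s F D" and G: "expansion s G E"
  shows "expansion s (F * G) (F * E + G * D)"
proof (rule expansion_mult_gen[OF F])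
  show "expansion s (fps_X ^ k * G) (fps_X ^ k * E)" for k
    using expansion_mono[OF expansion_X_power_mult[OF G]] by simp
  show "G \<in> O_shift 0"
    using expansion_mono[OF G, of 0] by (simp add: expansion_0)
qed

lemma expansion_1: "expansion s 1 0"
  unfolding expansion_zero_right by (rule O_shift_finite_support[of 1]) simp

lemma expansion_A: "expansion s A 1"
proof (cases s)
  case 0
  then show ?thesis by (simp add: expansion_0 A_in_O_shift)
next
  case (Suc t)
  have "(0 :: real fps) \<in> O_shift s" by (rule O_shift_finite_support[of 0]) simp
  then show ?thesis using Suc by (simp add: expansion_def fps_cutoff_one)
qed

lemma expansion_A_minus_1: "expansion s (A - 1) 1"
  using expansion_diff[OF expansion_A expansion_1, of s] by simp

section \<open>The reciprocal of \<open>A\<close> and powers of \<open>1 - inverse A\<close>\<close>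

lemma A_inverse: "A * inverse A = 1"
  by (simp add: inverse_mult_eq_1')

text \<open>With \<open>U = A - 1\<close>, the reciprocal \<open>B\<close> satisfies
  \<open>B = 1 - U * B\<close>. If \<open>C * a\<close> bounds the earlier coefficients of
  \<open>B\<close>, the inner terms of the convolution are bounded by \<open>C\<close> times the
  coefficient of \<open>U * U\<close>. That is \<open>o(a n)\<close>, so the bound
  propagates.\<close>

lemma inverse_A_in_O_shift: "inverse A \<in> O_shift 0"
proof -
  define U where "U = A - 1"
  define b where "b n = inverse A $ n" for n
  have U: "U $ n = (if n = 0 then 0 else a n)" for n
    by (simp add: U_def)
  have b0: "b 0 = 1" by (simp add: b_def)
  \<comment> \<open>The Leibniz rule gives \<open>U + U\<close>, whose constant term vanishes, so
    the leading term disappears.\<close>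
  have "expansion 1 (U * U) (U * 1 + U * 1)"
    unfolding U_def by (intro expansion_mult expansion_A_minus_1)
  then have "expansion 1 (U * U) 0"
    by (rule expansion_cong) (simp add: U)
  then have "(\<lambda>n. (U * U) $ n) \<in> O(\<lambda>n. a (n - 1))"
    by (simp add: expansion_zero_right O_shift_def)
  also have "(\<lambda>n. a (n - 1)) \<in> o(\<lambda>n. a n)"
    using a_shift_smallo[of 0] by simp
  finally have "eventually (\<lambda>n. norm ((U * U) $ n) \<le> 1 / 2 * norm (a n)) sequentially"
    by (rule landau_o.smallD) simp
  then obtain N0 where N0: "\<And>n. n \<ge> N0 \<Longrightarrow> \<bar>(U * U) $ n\<bar> \<le> 1 / 2 * \<bar>a n\<bar>"
    by (auto simp: eventually_at_top_linorder)
  \<comment> \<open>\<open>Suc\<close> keeps the indices of the inductive case positive, as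
    \<open>rec\<close> requires.\<close>
  define N where "N = Suc N0"
  \<comment> \<open>The sum settles the indices below \<open>N\<close>; the 2 gives
    \<open>C / 2 + 1 \<le> C\<close> for the inductive case.\<close>
  define C where "C = 2 + (\<Sum>n<N. \<bar>b n\<bar> / a n)"
  have nonneg: "\<bar>b n\<bar> / a n \<ge> 0" for n
    using a_pos[of n] by simp
  then have C2: "C \<ge> 2" by (simp add: C_def sum_nonneg)
  have rec: "b n = - (\<Sum>i=0..n. U $ i * b (n - i))" if "n > 0" for n
  proof -
    have "U * inverse A = 1 - inverse A"
      using A_inverse by (simp add: U_def algebra_simps)
    then have "(U * inverse A) $ n = - b n" using that by (simp add: b_def)
    then show ?thesis by (simp add: fps_mult_nth b_def)
  qed
  have "\<bar>b n\<bar> \<le> C * a n" for n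
  proof (induction n rule: less_induct)
    case (less n)
    show ?case
    proof (cases "n < N")
      case True
      then have "\<bar>b n\<bar> / a n \<le> (\<Sum>n<N. \<bar>b n\<bar> / a n)"
        using nonneg by (intro member_le_sum) auto
      then have "\<bar>b n\<bar> / a n \<le> C" by (simp add: C_def)
      then show ?thesis using a_pos[of n] by (simp add: field_simps)
    next
      case False
      then have n: "n > 0" "n \<ge> N0" by (auto simp: N_def)
      have "\<bar>b n\<bar> \<le> (\<Sum>i=0..n. \<bar>U $ i * b (n - i)\<bar>)"
        using rec[OF n(1)] by simp
      \<comment> \<open>The term \<open>i = 0\<close> vanishes, and \<open>i = n\<close> contributes
        \<open>a n\<close> because \<open>b 0 = 1\<close>. The induction hypothesis covers the terms
        in between.\<close>
      also have "\<dots> \<le> (\<Sum>i=0..n. C * (U $ i * U $ (n - i)) + (if i = n then a n else 0))"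
      proof (rule sum_mono)
        fix i assume i: "i \<in> {0..n}"
        consider "i = 0" | "i = n" | "0 < i" "i < n" using i by force
        then show "\<bar>U $ i * b (n - i)\<bar> \<le> C * (U $ i * U $ (n - i)) + (if i = n then a n else 0)"
        proof cases
          case 1
          then show ?thesis using a_pos[of n] by (simp add: U)
        next
          case 2
          then show ?thesis using n a_pos[of n] by (simp add: U b0)
        next
          case 3
          then have "\<bar>b (n - i)\<bar> \<le> C * a (n - i)" using less.IH by simp
          then have "a i * \<bar>b (n - i)\<bar> \<le> a i * (C * a (n - i))"
            using a_pos[of i] by (intro mult_left_mono) auto
          then show ?thesis using 3 a_pos[of i] by (simp add: U abs_mult mult_ac)
        qed
      qed
      also have "\<dots> = C * (U * U) $ n + a n"
        by (simp add: sum.distrib fps_mult_nth sum_distrib_left)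
      also have "\<dots> \<le> C * (1 / 2 * a n) + a n"
        using N0[OF n(2)] a_pos[of n] C2 by (intro add_right_mono mult_left_mono) auto
      also have "\<dots> \<le> C * a n"
        using mult_right_mono[OF C2, of "a n"] a_pos[of n] by linarith
      finally show ?thesis .
    qed
  qed
  then have "(\<lambda>n. b n) \<in> O(\<lambda>n. a n)"
    using a_pos by (intro bigoI[of _ C] always_eventually allI) (simp add: abs_of_pos)
  then show ?thesis by (simp add: O_shift_def b_def)
qed

text \<open>Applies the Leibniz rule to \<open>B = 1 - U * B\<close>. As \<open>U $ 0 = 0\<close>,
  order \<open>Suc s\<close> on the right needs only \<open>fps_X ^ k * B\<close> with
  \<open>k > 0\<close>, and there order \<open>s\<close> for \<open>B\<close> suffices.\<close>

lemma expansion_inverse: "expansion s (inverse A) (- (inverse A ^ 2))"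
proof (induction s)
  case 0
  then show ?case by (simp add: expansion_0 inverse_A_in_O_shift)
next
  case (Suc s)
  let ?U = "A - 1" and ?B = "inverse A"
  have "expansion (Suc s) (?U * ?B) (?U * (- (?B ^ 2)) + ?B * 1)"
  proof (rule expansion_mult_gen[OF expansion_A_minus_1 _ inverse_A_in_O_shift])
    fix k assume "?U $ k \<noteq> 0"
    then have "k > 0" by (cases k) auto
    then show "expansion (Suc s) (fps_X ^ k * ?B) (fps_X ^ k * - (?B ^ 2))"
      by (intro expansion_mono[OF expansion_X_power_mult[OF Suc]]) simp
  qed
  then have "expansion (Suc s) (1 - ?U * ?B) (0 - (?U * (- (?B ^ 2)) + ?B * 1))"
    by (rule expansion_diff[OF expansion_1])
  moreover have "1 - ?U * ?B = ?B"
    using A_inverse by (simp add: algebra_simps)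
  moreover have "0 - (?U * (- (?B ^ 2)) + ?B * 1) = - (?B ^ 2)"
  proof -
    have "A * ?B ^ 2 = ?B" using A_inverse by (simp add: power2_eq_square flip: mult.assoc)
    then show ?thesis by (simp add: algebra_simps)
  qed
  ultimately show ?case by simp
qed

lemma expansion_power:
  assumes "expansion s F D"
  shows "expansion s (F ^ m) (of_nat m * F ^ (m - 1) * D)"
proof (induction m)
  case 0
  then show ?case by (simp add: expansion_1)
next
  case (Suc m)
  \<comment> \<open>For \<open>m = 0\<close> the truncated exponent \<open>m - 1\<close> is
    harmless, since its term carries the factor \<open>of_nat m\<close>.\<close>
  have "F * (of_nat m * F ^ (m - 1) * D) + F ^ m * D = of_nat (Suc m) * F ^ (Suc m - 1) * D"
    by (cases m) (simp_all add: algebra_simps)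
  then show ?case
    using expansion_mult[OF assms Suc] by (simp only: power_Suc)
qed

text \<open>The power rule gives \<open>m * S ^ (m - 1) * (1 - S) ^ 2\<close>; multiplying out the
  square produces the second difference of the final formula.\<close>

lemma expansion_power_1_minus_inverse:
  assumes "m \<ge> 1"
  defines "S \<equiv> 1 - inverse A"
  shows "expansion s (S ^ m) (of_nat m * (S ^ (m - 1) - 2 * S ^ m + S ^ (m + 1)))"
proof -
  have "expansion s S (0 - - (inverse A ^ 2))"
    unfolding S_def by (intro expansion_diff expansion_1 expansion_inverse)
  then have "expansion s (S ^ m) (of_nat m * S ^ (m - 1) * inverse A ^ 2)"
    using expansion_power[of s S "inverse A ^ 2" m] by simp
  moreover have "inverse A = 1 - S" by (simp add: S_def)
  moreover have "S ^ (m - 1) * (1 - S) ^ 2 = S ^ (m - 1) - 2 * S ^ m + S ^ (m + 1)"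
    using assms(1) by (cases m) (simp_all add: power2_eq_square algebra_simps)
  ultimately show ?thesis by (simp add: mult.assoc)
qed

section \<open>Translation to the asymptotic scale of the theorem\<close>

definition scale :: "nat \<Rightarrow> nat \<Rightarrow> real" where
  "scale k n = real (n choose k) * (q ^ (n * k) / q ^ (k * (k + 1) div 2))"

text \<open>The exponent \<open>n * k - k * (k + 1) div 2\<close> equals
  \<open>k * (n - k) + (k choose 2)\<close>: the first summand comes from \<open>a_add\<close>, the
  second turns \<open>a k\<close> into \<open>1 / fact k\<close>.\<close>

lemma scale_eq:
  assumes "k \<le> n"
  shows "scale k n = a (n - k) / (fact k * a n)"
proof -
  have "k * k = (k choose 2) + k * (k + 1) div 2"
  proof -
    \<comment> \<open>Parity makes the halving exact, and what remains is a linear identity.\<close>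
    have "even (k * (k - 1))" by (cases k) auto
    then have "2 * (k choose 2) = k * (k - 1)" "2 * (k * (k + 1) div 2) = k * (k + 1)"
      by (simp_all add: choose_two)
    moreover have "k * (k - 1) + k * (k + 1) = 2 * (k * k)"
      by (cases k) simp_all
    ultimately show ?thesis by linarith
  qed
  moreover have "n * k = k * (n - k) + k * k"
    using assms by (metis le_add_diff_inverse2 add_mult_distrib2 mult.commute)
  ultimately have "n * k = k * (n - k) + (k choose 2) + k * (k + 1) div 2" by linarith
  then have "q ^ (n * k) / q ^ (k * (k + 1) div 2) = q ^ (k * (n - k)) * q ^ (k choose 2)"
    using q_pos by (simp add: power_add)
  then have "scale k n = q ^ (k choose 2) * (a k * a (n - k) / a n)"
    using a_add[of k "n - k"] assms a_pos[of n] by (simp add: scale_def)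
  also have "q ^ (k choose 2) * a k = 1 / fact k"
    using q_pos by (simp add: a_def power_inverse)
  then have "q ^ (k choose 2) * (a k * a (n - k) / a n) = a (n - k) / (fact k * a n)"
    by (metis (no_types, opaque_lifting) mult.assoc mult_1 times_divide_eq_left times_divide_eq_right divide_divide_eq_left)
  finally show ?thesis .
qed

lemma scale_smallo: "scale (Suc k) \<in> o(scale k)"
proof -
  define h where "h j n = a (n - j) * (1 / a n)" for j n
  have *: "eventually (\<lambda>n. scale j n = 1 / fact j * h j n) sequentially" for j
    using eventually_ge_at_top[of j] by eventually_elim (simp add: scale_eq h_def)
  have "h (Suc k) \<in> o(h k)"
    unfolding h_def by (rule landau_o.small.mult_right[OF a_shift_smallo])
  then have "(\<lambda>n. 1 / fact (Suc k) * h (Suc k) n) \<in> o(\<lambda>n. 1 / fact k * h k n)"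
    by (simp del: fact_Suc)
  then show ?thesis
    using landau_o.small.in_cong[OF *[of "Suc k"]] landau_o.small.cong[OF *[of k]] by simp
qed

text \<open>The condition at \<open>r\<close> is the expansion of order \<open>Suc r\<close>, which
  keeps the terms \<open>k \<le> r\<close>, divided by \<open>a n\<close>. The factor
  \<open>fact k\<close> offsets the one in \<open>scale_eq\<close>.\<close>

lemma asymp_series_expansion:
  assumes "\<And>s. expansion s F D"
  shows "asymp_series (\<lambda>n. F $ n / a n) (\<lambda>k. fact k * D $ k) scale"
  unfolding asymp_series_def
proof (intro conjI allI scale_smallo)
  fix r
  let ?E = "F - fps_cutoff (Suc r) D * A"
  have eq: "F $ n / a n - (\<Sum>k\<le>r. fact k * D $ k * scale k n) = ?E $ n * (1 / a n)" if "n \<ge> r" for n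
  proof -
    have "(fps_cutoff (Suc r) D * A) $ n = (\<Sum>k\<le>r. D $ k * a (n - k))"
      unfolding fps_mult_nth using that
      by (intro sum.mono_neutral_cong_right) auto
    moreover have "(\<Sum>k\<le>r. fact k * D $ k * scale k n) = (\<Sum>k\<le>r. D $ k * a (n - k)) / a n"
      using that by (auto simp: scale_eq sum_divide_distrib intro!: sum.cong)
    ultimately show ?thesis by (simp add: diff_divide_distrib)
  qed
  have "(\<lambda>n. ?E $ n) \<in> O(\<lambda>n. a (n - Suc r))"
    using assms[of "Suc r"] by (simp only: expansion_def O_shift_iff)
  then have "(\<lambda>n. ?E $ n * (1 / a n)) \<in> O(\<lambda>n. a (n - Suc r) * (1 / a n))"
    by (rule landau_o.big.mult_right)
  also have "(\<lambda>n. a (n - Suc r) * (1 / a n)) \<in> O(\<lambda>n. fact (Suc r) * scale (Suc r) n)"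
    by (intro bigthetaD1 bigthetaI_cong)
      (use eventually_ge_at_top[of "Suc r"] in \<open>eventually_elim, simp add: scale_eq\<close>)
  also have "O(\<lambda>n. fact (Suc r) * scale (Suc r) n) = O(scale (Suc r))"
    by simp
  finally have "(\<lambda>n. ?E $ n * (1 / a n)) \<in> O(scale (Suc r))" .
  moreover have "eventually (\<lambda>n. F $ n / a n - (\<Sum>k\<le>r. fact k * D $ k * scale k n) = ?E $ n * (1 / a n)) sequentially"
    using eventually_ge_at_top[of r] by eventually_elim (rule eq)
  ultimately show "(\<lambda>n. F $ n / a n - (\<Sum>k\<le>r. fact k * D $ k * scale k n)) \<in> O(scale (Suc r))"
    using landau_o.big.in_cong by fast
qed

end

theorem theorem4p9:
  fixes p q \<rho> :: real and m :: nat
  assumes "0 < p" and "p < 1"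
    and "q = 1 - p" and "\<rho> = p / q"
    and "m \<ge> 1"
  shows "asymp_series
           (\<lambda>n. it_sccs \<rho> m n / it \<rho> n)
           (\<lambda>k. real m * (it_sccs \<rho> (m - 1) k - 2 * it_sccs \<rho> m k + it_sccs \<rho> (m + 1) k))
           (\<lambda>k n. real (n choose k) * (q ^ (n * k) / q ^ (k * (k + 1) div 2)))"
proof -
  interpret rapid_growth q
    using assms by unfold_locales auto
  let ?S = "strong_egf (\<rho> - 1)"
  let ?D = "of_nat m * (?S ^ (m - 1) - 2 * ?S ^ m + ?S ^ (m + 1))"
  \<comment> \<open>Since \<open>p + q = 1\<close>, one has
    \<open>\<rho> + 1 = (p + q) / q = inverse q\<close>.\<close>
  have "\<rho> - 1 + 2 = inverse q"
    using assms by (simp add: field_simps)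
  then have A: "total_egf (\<rho> - 1) = A"
    by (intro fps_ext) (simp add: total_egf_def a_def)
  have "expansion s (?S ^ m) ?D" for s
    unfolding strong_egf_def A by (rule expansion_power_1_minus_inverse[OF \<open>m \<ge> 1\<close>])
  then have "asymp_series (\<lambda>n. (?S ^ m) $ n / a n) (\<lambda>k. fact k * ?D $ k) scale"
    by (rule asymp_series_expansion)
  \<comment> \<open>The factors \<open>fact n\<close> of the numerator and the denominator
    cancel.\<close>
  moreover have "(?S ^ m) $ n / a n = it_sccs \<rho> m n / it \<rho> n" for n
    by (simp add: it_sccs_eq it_eq A)
  moreover have "fact k * ?D $ k =
      real m * (it_sccs \<rho> (m - 1) k - 2 * it_sccs \<rho> m k + it_sccs \<rho> (m + 1) k)" for k
    by (simp only: it_sccs_eq fps_of_nat[symmetric] numeral_fps_const fps_mult_left_const_nth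
        fps_add_nth fps_sub_nth) (simp only: algebra_simps)
  moreover have "scale = (\<lambda>k n. real (n choose k) * (q ^ (n * k) / q ^ (k * (k + 1) div 2)))"
    by (simp add: scale_def fun_eq_iff)
  ultimately show ?thesis by (simp only:)
qed

end
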